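(* For every integer $n$ with $0\le n\le 3090$, $$\int_{0}^{\infty}\bigl(2\cos(t)+2\cos(3t)\bigr)\prod_{k=0}^{n}\operatorname{sinc}\Bigl(\frac{t}{2k+1}\Bigr)\,dt=\frac{\pi}{2},$$ and for every integer $n>3090$, $$\int_{0}^{\infty}\bigl(2\cos(t)+2\cos(3t)\bigr)\prod_{k=0}^{n}\operatorname{sinc}\Bigl(\frac{t}{2k+1}\Bigr)\,dt<\frac{\pi}{2}.$$
   Context: Here $\operatorname{sinc}(t)=\frac{\sin t}{t}$ for $t\neq 0$ and $\operatorname{sinc}(0)=1$. Integrals over $[0,\infty)$ are improper integrals, $\int_0^\infty=\lim_{R\to\infty}\int_0^R$ (for $n=0$ the integral is only conditionally convergent). *)

theory Defs
  imports "HOL-Probability.Probability"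
begin

text \<open>
  \<open>\<integral>\<^sub>0\<^sup>\<infinity> f = I\<close> as the limit of the proper integrals over \<open>[0, R]\<close>. This is a relation rather
  than a function so that convergence is part of the claim. The function \<open>sinc\<close> is the one from
  the theory \<open>Sinc_Integral\<close>.
\<close>

definition has_improper_integral :: "(real \<Rightarrow> real) \<Rightarrow> real \<Rightarrow> bool" where
  "has_improper_integral f I \<longleftrightarrow>
     (\<forall>R\<ge>0. f integrable_on {0..R}) \<and> ((\<lambda>R. integral {0..R} f) \<longlongrightarrow> I) at_top"

end

theory Submission
  imports Defs
begin

text \<open>
  The cosine factor is tuned to the first factor of the product:
  \<open>(2 cos t + 2 cos 3t) sin t = sin 4t\<close>, so the integral is
  \<open>\<integral> 4 sinc(4t) \<Prod>\<^sub>k sinc(t / (2k+1)) dt\<close> with \<open>k\<close> running from \<open>1\<close> to \<open>n\<close>. Put the frequency \<open>s\<close>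
  in place of \<open>4\<close> and call the result \<open>F\<^sub>n(s)\<close>.

  For the empty product, \<open>F\<^sub>0(s) = \<integral> sin(st)/t dt = (\<pi>/2) sgn s\<close>. Since
  \<open>2 sin(st) sin(bt) / t\<close> is the integral of \<open>sin(vt)\<close> over \<open>v\<close> in \<open>[s-b, s+b]\<close>, an additional factor
  \<open>sinc(bt)\<close> replaces \<open>F\<close> by its mean over that interval
  (\<open>trunc_transform_sinc_mult\<close> on \<open>[0, R]\<close>; the limit \<open>R \<rightarrow> \<infinity>\<close> is taken by dominated convergence
  in \<open>has_sine_transform_sinc_mult\<close>, as the truncated integrals are uniformly bounded). A
  nondecreasing function that equals \<open>\<pi>/2\<close> beyond \<open>S\<close> and is smaller before \<open>S\<close> is turned by such a
  mean into one with the same property for \<open>S + b\<close> (\<open>saturates_box_mean\<close>): the mean over a window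
  is \<open>\<pi>/2\<close> exactly as long as the window does not reach below \<open>S\<close>. Hence \<open>F\<^sub>n(4) = \<pi>/2\<close> iff
  \<open>1/3 + 1/5 + \<dots> + 1/(2n+1) \<le> 4\<close>, and otherwise \<open>F\<^sub>n(4) < \<pi>/2\<close>.

  It remains to see that this sum passes \<open>4\<close> between \<open>n = 3090\<close> and \<open>n = 3091\<close>. At \<open>n = 3091\<close> it
  exceeds \<open>4\<close> by only \<open>4 \<cdot> 10\<^sup>-\<^sup>5\<close>; the sum is expressed by harmonic numbers, and these by
  logarithms and Euler's constant.
\<close>

section \<open>Truncated sine transforms\<close>

text \<open>
  The kernel \<open>s * sinc (s * t)\<close> is \<open>sin (s * t) / t\<close> continued to \<open>t = 0\<close>; it is jointly continuous,
  which makes all integrals over bounded ranges unproblematic.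
\<close>

definition trunc_transform :: "(real \<Rightarrow> real) \<Rightarrow> real \<Rightarrow> real \<Rightarrow> real" where
  "trunc_transform w R s = integral {0..R} (\<lambda>t. s * sinc (s * t) * w t)"

text \<open>
  Besides convergence to \<open>F\<close>, a bound uniform in \<open>R\<close> and \<open>s\<close> is demanded, because it lets the
  limit in \<open>R\<close> pass through an integral over \<open>s\<close>.
\<close>

definition has_sine_transform :: "(real \<Rightarrow> real) \<Rightarrow> (real \<Rightarrow> real) \<Rightarrow> bool" where
  "has_sine_transform w F \<longleftrightarrow> continuous_on UNIV w \<and>
     (\<exists>B. \<forall>R s. \<bar>trunc_transform w R s\<bar> \<le> B) \<and>
     (\<forall>s. ((\<lambda>R. trunc_transform w R s) \<longlongrightarrow> F s) at_top)"

definition box_mean :: "real \<Rightarrow> (real \<Rightarrow> real) \<Rightarrow> real \<Rightarrow> real" where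
  "box_mean b F s = integral {-b..b} (\<lambda>u. F (s + u)) / (2 * b)"

lemma Si_0: "Si 0 = 0"
  using Si_neg[of 0] by simp

lemma trunc_transform_const_1:
  "trunc_transform (\<lambda>t. 1) R s = (if 0 \<le> R then Si (R * s) else 0)"
proof (cases "0 \<le> R")
  case True
  then have "((\<lambda>t. s * sinc (s * t)) has_integral (Si (R * s) - Si (0 * s))) {0..R}"
  proof (rule fundamental_theorem_of_calculus)
    fix t assume "t \<in> {0..R}"
    have "((\<lambda>t. Si (t * s)) has_real_derivative sinc (t * s) * s) (at t within {0..R})"
      by (rule DERIV_chain2[OF DERIV_Si]) (auto intro!: derivative_eq_intros)
    then show "((\<lambda>t. Si (t * s)) has_vector_derivative s * sinc (s * t)) (at t within {0..R})"
      by (simp only: has_real_derivative_iff_has_vector_derivative mult.commute[of s])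
  qed
  from integral_unique[OF this] True show ?thesis
    by (simp only: trunc_transform_def Si_0 mult_zero_left mult_1_right diff_zero if_True)
qed (simp add: trunc_transform_def)

lemma Si_scaled_at_top: "((\<lambda>R. Si (R * s)) \<longlongrightarrow> pi / 2 * sgn s) at_top"
proof -
  have pos: "((\<lambda>R. Si (R * r)) \<longlongrightarrow> pi / 2) at_top" if "0 < r" for r
    by (rule filterlim_compose[OF Si_at_top])
      (use that in \<open>auto intro!: filterlim_at_top_mult_tendsto_pos[OF tendsto_const] filterlim_ident\<close>)
  show ?thesis
  proof (cases s "0::real" rule: linorder_cases)
    case less
    have "\<forall>\<^sub>F R in at_top. - Si (R * - s) = Si (R * s)"
      using eventually_ge_at_top[of 0]
    proof eventually_elim
      case (elim R)
      then show ?case using Si_neg[of "R * - s"] less by (simp add: mult_nonneg_nonpos)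
    qed
    with tendsto_minus[OF pos[of "-s"]] less show ?thesis by (simp add: tendsto_cong)
  qed (use pos in \<open>simp_all add: Si_0\<close>)
qed

lemma has_sine_transform_const_1: "has_sine_transform (\<lambda>t. 1) (\<lambda>s. pi / 2 * sgn s)"
  unfolding has_sine_transform_def
proof (intro conjI allI)
  obtain B where B: "\<And>T. \<bar>Si T\<bar> \<le> B" using bounded_Si by blast
  moreover have "0 \<le> B" using B[of 0] by simp
  ultimately show "\<exists>B. \<forall>R s. \<bar>trunc_transform (\<lambda>t. 1) R s\<bar> \<le> B"
    by (auto simp: trunc_transform_const_1)
next
  fix s
  have "\<forall>\<^sub>F R in at_top. Si (R * s) = trunc_transform (\<lambda>t. 1) R s"
    using eventually_ge_at_top[of 0] by eventually_elim (simp add: trunc_transform_const_1)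
  with Si_scaled_at_top[of s]
  show "((\<lambda>R. trunc_transform (\<lambda>t. 1) R s) \<longlongrightarrow> pi / 2 * sgn s) at_top"
    by (rule Lim_transform_eventually)
qed simp

section \<open>A sinc factor averages the transform\<close>

text \<open>
  Away from \<open>t = 0\<close> this is \<open>cos ((s - b) t) - cos ((s + b) t) = 2 sin (s t) sin (b t)\<close>.
\<close>

lemma has_integral_sinc_window:
  fixes s t b :: real
  assumes b: "0 < b"
  shows "((\<lambda>u. (s + u) * sinc ((s + u) * t)) has_integral
    2 * b * (s * sinc (s * t) * sinc (b * t))) {-b..b}"
proof (cases "t = 0")
  case False
  have "((\<lambda>u. sin ((s + u) * t) / t) has_integral
      (- cos ((s + b) * t) / t^2 - - cos ((s + (-b)) * t) / t^2)) {-b..b}"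
  proof (rule fundamental_theorem_of_calculus)
    fix u
    show "((\<lambda>u. - cos ((s + u) * t) / t^2) has_vector_derivative sin ((s + u) * t) / t)
        (at u within {-b..b})"
      unfolding has_real_derivative_iff_has_vector_derivative[symmetric]
      using False by (auto intro!: derivative_eq_intros simp: field_simps power2_eq_square)
  qed (use b in auto)
  also have "- cos ((s + b) * t) / t^2 - - cos ((s + (-b)) * t) / t^2 =
      2 * b * (s * sinc (s * t) * sinc (b * t))"
    using False b
    by (simp add: distrib_right left_diff_distrib cos_add cos_diff field_simps power2_eq_square)
  also have "(\<lambda>u. sin ((s + u) * t) / t) = (\<lambda>u. (s + u) * sinc ((s + u) * t))"
    using False by auto
  finally show ?thesis .
next
  case True
  have "((\<lambda>u. s + u) has_integral ((s + b)^2 / 2 - (s + (-b))^2 / 2)) {-b..b}"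
    by (rule fundamental_theorem_of_calculus)
      (use b in \<open>auto intro!: derivative_eq_intros
        simp flip: has_real_derivative_iff_has_vector_derivative\<close>)
  also have "(s + b)^2 / 2 - (s + (-b))^2 / 2 = 2 * b * s"
    by (simp add: power2_eq_square field_simps)
  finally show ?thesis using True by simp
qed

lemma continuous_trunc_transform:
  assumes "continuous_on UNIV w"
  shows "continuous_on UNIV (trunc_transform w R)"
  unfolding continuous_on_eq_continuous_at[OF open_UNIV]
proof
  fix s
  let ?f = "\<lambda>s t. s * sinc (s * t) * w t"
  have "continuous_on (cball s 1 \<times> cbox 0 R) (\<lambda>(s, t). ?f s t)"
    unfolding split_def
    by (intro continuous_intros continuous_on_compose2[OF assms]) auto
  then have "continuous_on (cball s 1) (\<lambda>s. integral (cbox 0 R) (?f s))"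
    by (rule integral_continuous_on_param)
  then have "continuous_on (ball s 1) (trunc_transform w R)"
    unfolding trunc_transform_def cbox_interval
    by (rule continuous_on_subset) auto
  then show "isCont (trunc_transform w R) s"
    by (simp add: continuous_on_eq_continuous_at)
qed

lemma trunc_transform_sinc_mult:
  assumes "continuous_on UNIV w" "0 < b"
  shows "trunc_transform (\<lambda>t. sinc (b * t) * w t) R s = box_mean b (trunc_transform w R) s"
proof -
  let ?f = "\<lambda>u t. (s + u) * sinc ((s + u) * t) * w t"
  have "integral {-b..b} (\<lambda>u. trunc_transform w R (s + u)) =
      integral (cbox 0 R) (\<lambda>t. integral (cbox (-b) b) (\<lambda>u. ?f u t))"
    unfolding trunc_transform_def cbox_interval[symmetric]
    by (rule integral_swap_continuous, unfold split_def)
      (intro continuous_intros continuous_on_compose2[OF assms(1)]; auto)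
  also have "\<dots> = integral (cbox 0 R) (\<lambda>t. 2 * b * (s * sinc (s * t) * (sinc (b * t) * w t)))"
    by (intro integral_cong, unfold cbox_interval, subst integral_unique)
      (use has_integral_mult_left[OF has_integral_sinc_window[OF assms(2)]]
        in \<open>auto simp: mult.assoc\<close>)
  also have "\<dots> = 2 * b * trunc_transform (\<lambda>t. sinc (b * t) * w t) R s"
    unfolding trunc_transform_def by (simp split del: if_split)
  finally show ?thesis using assms(2) by (simp add: box_mean_def)
qed

lemma has_sine_transform_sinc_mult:
  assumes w: "has_sine_transform w F" and b: "0 < b"
  shows "has_sine_transform (\<lambda>t. sinc (b * t) * w t) (box_mean b F)"
proof -
  from w obtain B where cont: "continuous_on UNIV w"
    and B: "\<And>R s. \<bar>trunc_transform w R s\<bar> \<le> B"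
    and lim: "\<And>s. ((\<lambda>R. trunc_transform w R s) \<longlongrightarrow> F s) at_top"
    unfolding has_sine_transform_def by blast
  have int: "(\<lambda>u. trunc_transform w R (s + u)) integrable_on {-b..b}" for R s
    by (intro integrable_continuous_interval continuous_intros
        continuous_on_compose2[OF continuous_trunc_transform[OF cont]]) auto
  have "continuous_on UNIV (\<lambda>t. sinc (b * t) * w t)"
    by (intro continuous_intros cont)
  moreover have "\<bar>box_mean b (trunc_transform w R) s\<bar> \<le> B" for R s
  proof -
    have "norm (integral {-b..b} (\<lambda>u. trunc_transform w R (s + u))) \<le> integral {-b..b} (\<lambda>u. B)"
      by (rule integral_norm_bound_integral[OF int]) (use B in auto)
    then show ?thesis using b by (simp add: box_mean_def field_simps)
  qed
  moreover have "((\<lambda>R. box_mean b (trunc_transform w R) s) \<longlongrightarrow> box_mean b F s) at_top" for s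
    unfolding box_mean_def
  proof (intro tendsto_divide tendsto_const tendsto_at_topI_sequentially)
    fix X :: "nat \<Rightarrow> real" assume X: "filterlim X at_top sequentially"
    show "(\<lambda>n. integral {-b..b} (\<lambda>u. trunc_transform w (X n) (s + u))) \<longlonglongrightarrow>
        integral {-b..b} (\<lambda>u. F (s + u))"
      by (rule dominated_convergence(2)[where h = "\<lambda>_. B", OF int])
        (use B filterlim_compose[OF lim X] in auto)
  qed (use b in auto)
  ultimately show ?thesis
    unfolding has_sine_transform_def trunc_transform_sinc_mult[OF cont b] by blast
qed

section \<open>Where an averaged step function saturates\<close>

text \<open>
  The value at \<open>S\<close> itself is left open, so that \<open>sgn\<close>, which is \<open>0\<close> at its jump, is covered. After
  the first average the value there is \<open>c\<close> too (\<open>box_mean_eq\<close>).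
\<close>

definition saturates :: "(real \<Rightarrow> real) \<Rightarrow> real \<Rightarrow> real \<Rightarrow> bool" where
  "saturates F c S \<longleftrightarrow> mono F \<and> (\<forall>s<S. F s < c) \<and> (\<forall>s>S. F s = c)"

lemma saturates_le:
  assumes "saturates F c S"
  shows "F s \<le> c"
proof -
  have "F s \<le> F (max s (S + 1))"
    using assms by (intro monoD[of F]) (auto simp: saturates_def)
  also have "\<dots> = c"
    using assms by (auto simp: saturates_def)
  finally show ?thesis .
qed

lemma integrable_shifted_mono:
  fixes F :: "real \<Rightarrow> real"
  shows "mono F \<Longrightarrow> (\<lambda>u. F (s + u)) integrable_on {a..b}"
  by (intro integrable_on_mono_on) (auto simp: mono_on_def mono_def)

lemma box_mean_eq:
  assumes F: "saturates F c S" and b: "0 < b" and s: "S + b \<le> s"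
  shows "box_mean b F s = c"
proof -
  \<comment> \<open>For \<open>s = S + b\<close> the left end of the window is \<open>S\<close>, where the value of \<open>F\<close> is unknown.\<close>
  have "integral {-b..b} (\<lambda>u. F (s + u)) = integral {-b..b} (\<lambda>u. c)"
    by (rule integral_spike[of "{-b}"]) (use F s in \<open>auto simp: saturates_def\<close>)
  then show ?thesis using b by (simp add: box_mean_def)
qed

text \<open>
  Monotonicity makes strictness cheap: at an interior point \<open>s + m\<close> of the window with
  \<open>s + m < S\<close>, the value \<open>F (s + m) < c\<close> bounds \<open>F\<close> on the whole left part of the window.
\<close>

lemma box_mean_less:
  assumes F: "saturates F c S" and b: "0 < b" and s: "s < S + b"
  shows "box_mean b F s < c"
proof -
  have mono: "mono F" using F by (simp add: saturates_def)
  define m where "m = min b ((S - s - b) / 2)"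
  have m: "-b < m" "m \<le> b" "s + m < S"
    using b s by (auto simp: m_def min_def field_simps)
  have "integral {-b..b} (\<lambda>u. F (s + u)) =
      integral {-b..m} (\<lambda>u. F (s + u)) + integral {m..b} (\<lambda>u. F (s + u))"
    by (rule Henstock_Kurzweil_Integration.integral_combine[symmetric])
      (use m mono in \<open>auto intro: integrable_shifted_mono\<close>)
  also have "\<dots> \<le> integral {-b..m} (\<lambda>u. F (s + m)) + integral {m..b} (\<lambda>u. c)"
    by (intro add_mono integral_le integrable_shifted_mono mono integrable_const_ivl
        saturates_le[OF F])
      (use mono in \<open>auto simp: mono_def\<close>)
  also have "\<dots> = (m + b) * F (s + m) + (b - m) * c"
    using m by simp
  also have "\<dots> < (m + b) * c + (b - m) * c"
    using m F by (simp add: saturates_def)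
  finally show ?thesis using b by (simp add: box_mean_def field_simps)
qed

lemma saturates_box_mean:
  assumes F: "saturates F c S" and b: "0 < b"
  shows "saturates (box_mean b F) c (S + b)"
proof -
  have mono: "mono F" using F by (simp add: saturates_def)
  have "mono (box_mean b F)"
    unfolding box_mean_def
    by (intro monoI divide_right_mono integral_le integrable_shifted_mono mono)
      (use mono b in \<open>auto simp: mono_def\<close>)
  then show ?thesis
    unfolding saturates_def using box_mean_eq[OF F b] box_mean_less[OF F b] by auto
qed

lemma ex_sine_transform_prod_sinc:
  fixes b :: "nat \<Rightarrow> real" and n :: nat
  assumes "\<And>k. 0 < b k"
  shows "\<exists>F. has_sine_transform (\<lambda>t. \<Prod>k=1..n. sinc (b k * t)) F \<and>
    saturates F (pi / 2) (\<Sum>k=1..n. b k) \<and> (0 < n \<longrightarrow> F (\<Sum>k=1..n. b k) = pi / 2)"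
proof (induction n)
  case 0
  have "saturates (\<lambda>s. pi / 2 * sgn s) (pi / 2) 0"
    by (auto simp: saturates_def sgn_if intro!: monoI)
  with has_sine_transform_const_1 show ?case by auto
next
  case (Suc n)
  then obtain F where F: "has_sine_transform (\<lambda>t. \<Prod>k=1..n. sinc (b k * t)) F"
    and sat: "saturates F (pi / 2) (\<Sum>k=1..n. b k)"
    by blast
  have "(\<lambda>t. \<Prod>k=1..Suc n. sinc (b k * t)) =
      (\<lambda>t. sinc (b (Suc n) * t) * (\<Prod>k=1..n. sinc (b k * t)))"
    by (simp add: mult.commute del: if_split)
  then show ?case
    using has_sine_transform_sinc_mult[OF F assms[of "Suc n"]]
      saturates_box_mean[OF sat assms[of "Suc n"]]
      box_mean_eq[OF sat assms[of "Suc n"] order_refl]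
    by (intro exI[of _ "box_mean (b (Suc n)) F"]) (simp add: add.commute split del: if_split)
qed

section \<open>The integral as a sine transform at frequency 4\<close>

lemma cos_sum_mult_sinc: "(2 * cos t + 2 * cos (3 * t)) * sinc t = 4 * sinc (4 * t)" for t :: real
proof (cases "t = 0")
  case False
  have "2 * cos t + 2 * cos (3 * t) = 4 * cos (2 * t) * cos t"
    using cos_add[of "2 * t" t, simplified] cos_diff[of "2 * t" t, simplified] by linarith
  moreover have "sin (4 * t) = 4 * cos (2 * t) * cos t * sin t"
    using sin_double[of "2 * t"] sin_double[of t] by (simp add: algebra_simps)
  ultimately show ?thesis using False by simp
qed simp

lemma ex_improper_integral_cos_sum_prod_sinc:
  fixes n :: nat
  defines "S \<equiv> \<Sum>k=1..n. 1 / (2 * real k + 1)"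
  shows "\<exists>I. has_improper_integral
      (\<lambda>t. (2 * cos t + 2 * cos (3 * t)) * (\<Prod>k=0..n. sinc (t / (2 * real k + 1)))) I \<and>
    (S \<le> 4 \<longrightarrow> I = pi / 2) \<and> (4 < S \<longrightarrow> I < pi / 2)"
proof -
  let ?w = "\<lambda>t. \<Prod>k=1..n. sinc (1 / (2 * real k + 1) * t)"
  obtain F where F: "has_sine_transform ?w F" and sat: "saturates F (pi / 2) S"
    and edge: "0 < n \<Longrightarrow> F S = pi / 2"
    using ex_sine_transform_prod_sinc[of "\<lambda>k. 1 / (2 * real k + 1)" n] unfolding S_def by auto
  have eq: "(\<lambda>t. (2 * cos t + 2 * cos (3 * t)) * (\<Prod>k=0..n. sinc (t / (2 * real k + 1)))) =
      (\<lambda>t. 4 * sinc (4 * t) * ?w t)"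
  proof
    fix t :: real
    have "(\<Prod>k=0..n. sinc (t / (2 * real k + 1))) = sinc t * ?w t"
      by (subst prod.atLeast_Suc_atMost)
        (simp_all only: times_divide_eq_left mult_1 of_nat_0 mult_zero_right add_0 div_by_1
          One_nat_def zero_le)
    then show "(2 * cos t + 2 * cos (3 * t)) * (\<Prod>k=0..n. sinc (t / (2 * real k + 1))) =
        4 * sinc (4 * t) * ?w t"
      unfolding cos_sum_mult_sinc[symmetric] by (simp only: mult.assoc)
  qed
  have "has_improper_integral (\<lambda>t. 4 * sinc (4 * t) * ?w t) (F 4)"
    unfolding has_improper_integral_def
  proof (intro conjI allI impI)
    have "continuous_on UNIV ?w" using F unfolding has_sine_transform_def by blast
    then show "(\<lambda>t. 4 * sinc (4 * t) * ?w t) integrable_on {0..R}" for R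
      by (intro integrable_continuous_interval continuous_intros
          continuous_on_subset[of UNIV ?w]) auto
    show "((\<lambda>R. integral {0..R} (\<lambda>t. 4 * sinc (4 * t) * ?w t)) \<longlongrightarrow> F 4) at_top"
      using F unfolding has_sine_transform_def trunc_transform_def by blast
  qed
  moreover have "F 4 = pi / 2" if "S \<le> 4"
  proof (cases "S = 4")
    case True
    then have "0 < n" by (cases n) (auto simp: S_def)
    then show ?thesis using edge True by simp
  next
    case False
    then show ?thesis using sat that by (simp add: saturates_def)
  qed
  moreover have "F 4 < pi / 2" if "4 < S"
    using sat that by (simp add: saturates_def)
  ultimately show ?thesis unfolding eq by blast
qed

section \<open>Locating the index where the sum of odd reciprocals passes 4\<close>

lemma sum_odd_reciprocals:
  "(\<Sum>k=1..n. 1 / (2 * real k + 1)) = harm (2 * n + 1) - harm n / 2 - 1"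
proof (induction n)
  case 0
  show ?case by (simp add: harm_expand)
next
  case (Suc n)
  have "harm (2 * Suc n + 1) = harm (2 * n + 1) + 1 / (2 * (real n + 1)) + 1 / (2 * real n + 3)"
    by (simp add: harm_Suc inverse_eq_divide add_ac)
  moreover have "harm (Suc n) / 2 = harm n / 2 + 1 / (2 * (real n + 1))"
    by (simp add: harm_Suc inverse_eq_divide add_divide_distrib add_ac)
  moreover have "(\<Sum>k=1..Suc n. 1 / (2 * real k + 1)) =
      (\<Sum>k=1..n. 1 / (2 * real k + 1)) + 1 / (2 * real n + 3)"
    by (simp add: add_ac)
  ultimately show ?case using Suc by linarith
qed

lemma ln_2_bounds: "ln (2::real) \<in> {0.693147..0.693148}"
  using ln_approx_bounds[of 2 6] by (simp add: eval_nat_numeral)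

text \<open>
  Rounding every reciprocal down to a multiple of \<open>1/N\<close> turns the evaluation of a harmonic number
  into integer arithmetic, at the price of an error of at most \<open>n/N\<close>.
\<close>

lemma harm_fixed_point_bounds:
  fixes N :: int and n :: nat
  assumes "0 < N"
  defines "A \<equiv> real_of_int (\<Sum>k\<leftarrow>[1..int n]. N div k)"
  shows "harm n \<in> {A / N..(A + n) / N}"
proof -
  have set: "real_of_int (\<Sum>k\<leftarrow>[1..int n]. N div k) = (\<Sum>k=1..n. real_of_int (N div int k))"
  proof (induction n)
    case (Suc n)
    have "[1..int (Suc n)] = [1..int n] @ [int (Suc n)]"
      by (subst upto_rec2) auto
    then show ?case using Suc by simp
  qed simp
  have *: "real_of_int (N div int k) \<le> N * inverse (real k)"
      "N * inverse (real k) \<le> real_of_int (N div int k) + 1" for k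
    using floor_divide_of_int_eq[of N "int k", where 'a = real]
      floor_correct[of "real_of_int N / real_of_int (int k)"]
    by (auto simp: divide_inverse)
  have "A \<le> (\<Sum>k=1..n. N * inverse (real k))" "(\<Sum>k=1..n. N * inverse (real k)) \<le> A + n"
    unfolding A_def set using *
    by (auto intro: sum_mono order.trans[OF sum_mono[OF *(2)]] simp: sum.distrib)
  then show ?thesis using assms(1) by (simp add: harm_def field_simps sum_distrib_left)
qed

lemma harm_96_bounds: "harm 96 \<in> {5.146763::real..5.146764}"
proof -
  define m where "m = (\<Sum>k\<leftarrow>[1..96::int]. 10^9 div k)"
  have "5146763000 \<le> (\<Sum>k\<leftarrow>[1..96::int]. 10^9 div k) \<and>
      (\<Sum>k\<leftarrow>[1..96::int]. 10^9 div k) \<le> 5146763900"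
    by code_simp
  then have "real_of_int m \<in> {5146763000..5146763900}"
    unfolding m_def[symmetric] by simp
  moreover have "harm 96 \<in> {real_of_int m / 10^9..(real_of_int m + 96) / 10^9}"
    using harm_fixed_point_bounds[of "10^9" 96] unfolding of_nat_numeral m_def[symmetric] by simp
  ultimately show ?thesis by simp
qed

text \<open>
  The bounds \<open>euler_mascheroni_bounds\<close> say that \<open>harm m - ln (m + 1) + 1 / (2 m)\<close> is Euler's constant
  \<open>\<gamma>\<close> up to \<open>O(m\<^sup>-\<^sup>2)\<close>, so the sum for \<open>n\<close> is close to \<open>\<gamma>/2 + ln 2 + ln (n + 1) / 2 - 1\<close>.
  They are also used for \<open>m = 96\<close> to get \<open>\<gamma>\<close> from an explicit harmonic number. Twice the sum then
  involves \<open>ln (4 (n + 1) / 97)\<close>, and \<open>m = 96\<close> is chosen because both \<open>4 \<cdot> 3091 = 12364\<close> and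
  \<open>4 \<cdot> 3092 = 12368\<close> are close to \<open>128 \<cdot> 97 = 12416\<close>: the logarithm is \<open>7 ln 2\<close> up to a correction that
  \<open>ln x \<le> x - 1\<close> bounds well enough.
\<close>

lemma sum_odd_reciprocals_3090: "(\<Sum>k=1..3090. 1 / (2 * real k + 1)) \<le> 4"
  and sum_odd_reciprocals_3091: "4 < (\<Sum>k=1..3091. 1 / (2 * real k + 1))"
proof -
  have gamma: "euler_mascheroni \<le> harm 96 - ln 97 + 1 / (192::real)"
    "harm 96 - ln 97 + 1 / 194 \<le> (euler_mascheroni::real)"
    using euler_mascheroni_bounds[of 96] by (simp_all add: inverse_eq_divide)
  have *: "ln (128 * (97::real)) = 7 * ln 2 + ln 97"
    using ln_realpow[of "2::real" 7] by (subst ln_mult) auto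
  have "ln 3091 + 2 * ln 2 = ln (128 * (97::real)) + ln (12364 / 12416)"
    using ln_realpow[of "2::real" 2] ln_mult[of 3091 "4::real"]
      ln_div[of "12364" "12416::real"] by simp
  also have "ln (12364 / 12416 :: real) \<le> - 52 / 12416"
    using ln_le_minus_one[of "12364 / 12416"] by simp
  finally have u: "ln 3091 + 2 * ln (2::real) \<le> 7 * ln 2 + ln 97 - 52 / 12416" using * by simp
  have "ln 3092 + 2 * ln 2 = ln (128 * (97::real)) - ln (12416 / 12368)"
    using ln_realpow[of "2::real" 2] ln_mult[of 3092 "4::real"]
      ln_div[of "12416" "12368::real"] by simp
  moreover have "ln (12416 / 12368 :: real) \<le> 48 / 12368"
    using ln_le_minus_one[of "12416 / 12368"] by simp
  ultimately have l: "ln 3092 + 2 * ln (2::real) \<ge> 7 * ln 2 + ln 97 - 48 / 12368" using * by simp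
  have h1: "harm 6181 \<le> euler_mascheroni + ln 2 + ln 3091 - 1 / (12364::real)"
    using euler_mascheroni_bounds[of 6181] ln_mult[of "2::real" 3091]
    by (simp add: inverse_eq_divide)
  have h2: "euler_mascheroni + ln 3091 - 1 / 6180 \<le> (harm 3090 :: real)"
    using euler_mascheroni_bounds[of 3090] by (simp add: inverse_eq_divide)
  show "(\<Sum>k=1..3090. 1 / (2 * real k + 1)) \<le> 4"
    using sum_odd_reciprocals[of 3090] h1 h2 u gamma harm_96_bounds ln_2_bounds by simp
  have h3: "harm 6183 \<ge> euler_mascheroni + ln 2 + ln 3092 - 1 / (12366::real)"
    using euler_mascheroni_bounds[of 6183] ln_mult[of "2::real" 3092]
    by (simp add: inverse_eq_divide)
  have h4: "euler_mascheroni + ln 3092 - 1 / 6184 \<ge> (harm 3091 :: real)"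
    using euler_mascheroni_bounds[of 3091] by (simp add: inverse_eq_divide)
  show "4 < (\<Sum>k=1..3091. 1 / (2 * real k + 1))"
    using sum_odd_reciprocals[of 3091] h3 h4 l gamma harm_96_bounds ln_2_bounds by simp
qed

theorem mainTheorem1:
  shows "(\<forall>n::nat. n \<le> 3090 \<longrightarrow>
            has_improper_integral
              (\<lambda>t. (2 * cos t + 2 * cos (3 * t)) * (\<Prod>k=0..n. sinc (t / (2 * real k + 1))))
              (pi / 2)) \<and>
         (\<forall>n::nat. n > 3090 \<longrightarrow>
            (\<exists>I. has_improper_integral
              (\<lambda>t. (2 * cos t + 2 * cos (3 * t)) * (\<Prod>k=0..n. sinc (t / (2 * real k + 1)))) I
              \<and> I < pi / 2))"
proof (intro conjI allI impI)
  have mono: "(\<Sum>k=1..m. 1 / (2 * real k + 1)) \<le> (\<Sum>k=1..n. 1 / (2 * real k + 1))"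
    if "m \<le> n" for m n :: nat
    using that by (intro sum_mono2) auto
  fix n :: nat
  show "has_improper_integral
      (\<lambda>t. (2 * cos t + 2 * cos (3 * t)) * (\<Prod>k=0..n. sinc (t / (2 * real k + 1)))) (pi / 2)"
    if "n \<le> 3090"
    using ex_improper_integral_cos_sum_prod_sinc[of n]
      order.trans[OF mono[OF that] sum_odd_reciprocals_3090] by blast
  show "\<exists>I. has_improper_integral
      (\<lambda>t. (2 * cos t + 2 * cos (3 * t)) * (\<Prod>k=0..n. sinc (t / (2 * real k + 1)))) I \<and>
      I < pi / 2"
    if "n > 3090"
  proof -
    from that have "3091 \<le> n" by linarith
    from less_le_trans[OF sum_odd_reciprocals_3091 mono[OF this]]
    show ?thesis using ex_improper_integral_cos_sum_prod_sinc[of n] by blast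
  qed
qed

end
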